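(* Let $A,B\in M_n(H)$ be $n\times n$ matrices over the commutative quaternions $H$. If $AB=I$, then $BA=I$, where $I$ is the $n\times n$ identity matrix.
   Context: The commutative quaternions are the real algebra $H=\{q=t+ix+jy+kz : t,x,y,z\in\mathbb{R}\}$ with $\mathbb{R}$-basis $1,i,j,k$ and commutative bilinear multiplication determined by $i^2=k^2=-1$, $j^2=1$, $ijk=-1$, $ij=ji=k$, $jk=kj=i$, $ki=ik=-j$. $M_n(H)$ is the set of $n\times n$ matrices with entries in $H$, with ordinary matrix addition and multiplication. *)

theory Defs
  imports "HOL-Analysis.Determinants"
begin

text \<open>\<open>CQuat t x y z\<close> stands for $t + ix + jy + kz$.\<close>

datatype cquat = CQuat (cq_t: real) (cq_x: real) (cq_y: real) (cq_z: real)

lemma cquat_eq_iff: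
  "p = q \<longleftrightarrow> cq_t p = cq_t q \<and> cq_x p = cq_x q \<and> cq_y p = cq_y q \<and> cq_z p = cq_z q"
  by (cases p; cases q) simp

text \<open>The product is the bilinear extension of the multiplication table of $1, i, j, k$;
  the table itself is proved below.\<close>

instantiation cquat :: comm_ring_1
begin

definition "0 = CQuat 0 0 0 0"

definition "1 = CQuat 1 0 0 0"

definition "p + q = CQuat (cq_t p + cq_t q) (cq_x p + cq_x q) (cq_y p + cq_y q) (cq_z p + cq_z q)"

definition "- p = CQuat (- cq_t p) (- cq_x p) (- cq_y p) (- cq_z p)"

definition "p - q = CQuat (cq_t p - cq_t q) (cq_x p - cq_x q) (cq_y p - cq_y q) (cq_z p - cq_z q)"

definition "p * q = CQuat
  (cq_t p * cq_t q - cq_x p * cq_x q + cq_y p * cq_y q - cq_z p * cq_z q)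
  (cq_t p * cq_x q + cq_x p * cq_t q + cq_y p * cq_z q + cq_z p * cq_y q)
  (cq_t p * cq_y q + cq_y p * cq_t q - cq_x p * cq_z q - cq_z p * cq_x q)
  (cq_t p * cq_z q + cq_z p * cq_t q + cq_x p * cq_y q + cq_y p * cq_x q)"

instance
  by standard
    (simp_all add: zero_cquat_def one_cquat_def plus_cquat_def uminus_cquat_def
      minus_cquat_def times_cquat_def algebra_simps)

end

instantiation cquat :: real_algebra_1
begin

definition "r *\<^sub>R q = CQuat (r * cq_t q) (r * cq_x q) (r * cq_y q) (r * cq_z q)"

instance
  by standard
    (simp_all add: zero_cquat_def one_cquat_def plus_cquat_def times_cquat_def
      scaleR_cquat_def cquat_eq_iff algebra_simps)

end

definition cq_i :: cquat where "cq_i = CQuat 0 1 0 0"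

definition cq_j :: cquat where "cq_j = CQuat 0 0 1 0"

definition cq_k :: cquat where "cq_k = CQuat 0 0 0 1"

lemma CQuat_eq_basis: "CQuat t x y z = t *\<^sub>R 1 + x *\<^sub>R cq_i + y *\<^sub>R cq_j + z *\<^sub>R cq_k"
  by (simp add: one_cquat_def plus_cquat_def scaleR_cquat_def cq_i_def cq_j_def cq_k_def)

lemma cquat_mult_table:
  "cq_i\<^sup>2 = - 1" "cq_k\<^sup>2 = - 1" "cq_j\<^sup>2 = 1" "cq_i * cq_j * cq_k = - 1"
  "cq_i * cq_j = cq_k" "cq_j * cq_i = cq_k"
  "cq_j * cq_k = cq_i" "cq_k * cq_j = cq_i"
  "cq_k * cq_i = - cq_j" "cq_i * cq_k = - cq_j"
  by (simp_all add: power2_eq_square one_cquat_def uminus_cquat_def times_cquat_def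
      cq_i_def cq_j_def cq_k_def)

end

theory Submission imports Defs begin

text \<open>
  The algebra is \<open>\<complex> \<times> \<complex>\<close> in disguise. Since \<open>j\<^sup>2 = 1\<close>, a homomorphism into a field must send
  \<open>j\<close> to \<open>1\<close> or to \<open>-1\<close>; each choice, together with sending \<open>i\<close> to the imaginary unit (and hence
  \<open>k = ij\<close> to plus or minus it), gives a ring homomorphism \<open>cq_hom\<close> into \<open>\<complex>\<close>, and the two
  together determine a commutative quaternion. A homomorphism applied entrywise respects matrix
  products, so \<open>AB = I\<close> passes to complex matrices, where one-sided inverses of square matrices
  are two-sided. The images of \<open>BA\<close> under both homomorphisms are therefore the identity, and by
  joint injectivity \<open>BA\<close> is the identity as well.
\<close>

lemma map_matrix_mat_1:
  assumes "f 0 = 0" "f 1 = 1"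
  shows "map_matrix f (mat 1) = mat 1"
  using assms by (simp add: vec_eq_iff mat_def)

lemma map_matrix_mult:
  fixes f :: "'r::semiring_1 \<Rightarrow> 'k::semiring_1"
    and A :: "'r ^ 'n ^ 'm" and B :: "'r ^ 'p ^ 'n"
  assumes zero: "f 0 = 0"
    and add: "\<And>p q. f (p + q) = f p + f q"
    and mult: "\<And>p q. f (p * q) = f p * f q"
  shows "map_matrix f (A ** B) = map_matrix f A ** map_matrix f B"
proof -
  have "f (sum g UNIV) = (\<Sum>k\<in>UNIV. f (g k))" for g :: "'n \<Rightarrow> 'r"
    using sum_comp_morphism[of f g UNIV] zero add by (simp add: o_def)
  then show ?thesis
    by (simp add: vec_eq_iff matrix_matrix_mult_def mult)
qed

text \<open>
  Linear algebra over the target field turns the right inverse of the image of \<open>A\<close> into a left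
  inverse. As \<open>f\<close> may have a kernel, this constrains only the image of \<open>B ** A\<close>, not the product
  itself.
\<close>
lemma map_matrix_one_sided_inverse:
  fixes f :: "'r::semiring_1 \<Rightarrow> 'k::field" and A B :: "'r ^ 'n ^ 'n"
  assumes zero: "f 0 = 0" and one: "f 1 = 1"
    and add: "\<And>p q. f (p + q) = f p + f q"
    and mult: "\<And>p q. f (p * q) = f p * f q"
    and AB: "A ** B = mat 1"
  shows "map_matrix f (B ** A) = mat 1"
proof -
  have "map_matrix f A ** map_matrix f B = mat 1"
    using map_matrix_mult[of f A B, OF zero add mult] AB
    by (simp add: map_matrix_mat_1 zero one)
  then have "map_matrix f B ** map_matrix f A = mat 1"
    by (simp add: matrix_left_right_inverse)
  then show ?thesis
    by (simp add: map_matrix_mult[of f B A, OF zero add mult])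
qed

text \<open>The real-linear map with \<open>i \<mapsto> \<i>\<close>, \<open>j \<mapsto> s\<close> and \<open>k \<mapsto> s\<i>\<close>.\<close>
definition cq_hom :: "real \<Rightarrow> cquat \<Rightarrow> complex" where
  "cq_hom s q = Complex (cq_t q + s * cq_y q) (cq_x q + s * cq_z q)"

lemma cq_hom_0: "cq_hom s 0 = 0"
  and cq_hom_1: "cq_hom s 1 = 1"
  and cq_hom_add: "cq_hom s (p + q) = cq_hom s p + cq_hom s q"
  by (simp_all add: cq_hom_def zero_cquat_def one_cquat_def plus_cquat_def complex_eq_iff
      algebra_simps)

text \<open>Multiplicativity asks that the image \<open>s\<close> of \<open>j\<close> satisfy the relation \<open>j\<^sup>2 = 1\<close>.\<close>
lemma cq_hom_mult:
  assumes "s = 1 \<or> s = - 1"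
  shows "cq_hom s (p * q) = cq_hom s p * cq_hom s q"
  using assms by (auto simp: cq_hom_def times_cquat_def complex_eq_iff algebra_simps)

text \<open>
  The two images give the sums and the differences of the coordinate pairs \<open>(t, y)\<close> and \<open>(x, z)\<close>,
  and these recover the coordinates.
\<close>
lemma cq_hom_jointly_injective:
  assumes "cq_hom 1 p = cq_hom 1 q" "cq_hom (- 1) p = cq_hom (- 1) q"
  shows "p = q"
  using assms by (simp add: cq_hom_def cquat_eq_iff)

theorem theorem4p2:
  fixes A B :: "cquat ^ 'n ^ 'n"
  assumes "A ** B = mat 1"
  shows "B ** A = mat 1"
proof -
  have image: "map_matrix (cq_hom s) (B ** A) = map_matrix (cq_hom s) (mat 1)"
    if "s = 1 \<or> s = - 1" for s
    using map_matrix_one_sided_inverse[of "cq_hom s" A B,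
        OF cq_hom_0 cq_hom_1 cq_hom_add cq_hom_mult[OF that] assms]
    by (simp add: map_matrix_mat_1 cq_hom_0 cq_hom_1)
  have "cq_hom s ((B ** A) $ a $ b) = cq_hom s (mat 1 $ a $ b)"
    if "s = 1 \<or> s = - 1" for s and a b :: 'n
    using image[OF that] by (metis nth_map_matrix)
  then show ?thesis
    by (auto simp: vec_eq_iff intro!: cq_hom_jointly_injective)
qed

end
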